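(* Let $\mathbf F_q$ be the finite field with $q$ elements and $m$ a positive integer. For $n\ge0$ let $c_{q,m}(n)$ be the number of isomorphism classes of $m$-dimensional modules over the polynomial algebra $\mathbf F_q[x_1,\dots,x_n]$. Then $h_{q,m}(t)=\sum_{n=0}^\infty c_{q,m}(n)t^n$ is a rational function of $t$. *)

theory Defs
  imports
    "Jordan_Normal_Form.VS_Connect"
    "HOL-Library.Poly_Mapping"
    "HOL-Computational_Algebra.Polynomial_FPS"
begin

hide_const (open) Multiset.mult Polynomial.smult Modules.module Modules.module_hom

text \<open>
  Polynomials are finitely supported functions from monomials (exponent vectors
  \<open>nat \<Rightarrow>\<^sub>0 nat\<close>) to coefficients; \<open>mpoly_ring n\<close> is the subring of those in which only the
  variables with index below \<open>n\<close> occur.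
\<close>

definition mpoly_ring :: "nat \<Rightarrow> ((nat \<Rightarrow>\<^sub>0 nat) \<Rightarrow>\<^sub>0 'a::comm_ring_1) ring" where
  "mpoly_ring n =
    \<lparr> carrier = {p. \<forall>e \<in> Poly_Mapping.keys p. Poly_Mapping.keys e \<subseteq> {..<n}},
      mult = (*), one = 1, zero = 0, add = (+) \<rparr>"

definition mpoly_const :: "'a::zero \<Rightarrow> (nat \<Rightarrow>\<^sub>0 nat) \<Rightarrow>\<^sub>0 'a" where
  "mpoly_const c = Poly_Mapping.single 0 c"

definition underlying_vs ::
    "((nat \<Rightarrow>\<^sub>0 nat) \<Rightarrow>\<^sub>0 'a::zero, 'v) module \<Rightarrow> ('a, 'v) module" where
  "underlying_vs M =
    \<lparr> carrier = carrier M, mult = mult M, one = one M, zero = zero M, add = add M,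
      smult = (\<lambda>c v. mpoly_const c \<odot>\<^bsub>M\<^esub> v) \<rparr>"

definition is_mpoly_module ::
    "nat \<Rightarrow> nat \<Rightarrow> ((nat \<Rightarrow>\<^sub>0 nat) \<Rightarrow>\<^sub>0 'a::field, 'v) module \<Rightarrow> bool" where
  "is_mpoly_module n m M \<longleftrightarrow>
    module (mpoly_ring n) M \<and>
    vectorspace.fin_dim class_ring (underlying_vs M) \<and>
    vectorspace.dim class_ring (underlying_vs M) = m"

definition module_isomorphic ::
    "('r, 'c) ring_scheme \<Rightarrow> ('r, 'v, 'd) module_scheme \<Rightarrow> ('r, 'w, 'e) module_scheme \<Rightarrow> bool" where
  "module_isomorphic R M N \<longleftrightarrow>
    (\<exists>f \<in> module_hom R M N. bij_betw f (carrier M) (carrier N))"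

text \<open>
  For a finite coefficient field, a finite-dimensional module is a finite set, so every
  isomorphism class has a representative whose underlying set consists of natural numbers
  (lemma \<open>mpoly_module_nat_representative\<close> below). Counting isomorphism classes of modules
  with carrier in \<^typ>\<open>nat\<close> therefore counts all isomorphism classes.
  There are finitely many of them, since a module structure on a fixed finite vector space
  is determined by the actions of the \<open>n\<close> variables, so \<open>card\<close> is the honest count.
\<close>

definition mpoly_modules ::
    "nat \<Rightarrow> nat \<Rightarrow> ((nat \<Rightarrow>\<^sub>0 nat) \<Rightarrow>\<^sub>0 'a::field, nat) module set" where
  "mpoly_modules n m = {M. is_mpoly_module n m M}"

definition mpoly_module_iso ::
    "nat \<Rightarrow> nat \<Rightarrow> ((nat \<Rightarrow>\<^sub>0 nat) \<Rightarrow>\<^sub>0 'a::field, nat) module rel" where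
  "mpoly_module_iso n m =
    {(M, N). M \<in> mpoly_modules n m \<and> N \<in> mpoly_modules n m \<and>
             module_isomorphic (mpoly_ring n) M N}"

definition num_iso_classes :: "'a::{field, finite} itself \<Rightarrow> nat \<Rightarrow> nat \<Rightarrow> nat" where
  "num_iso_classes _ m n =
    card ((mpoly_modules n m :: ((nat \<Rightarrow>\<^sub>0 nat) \<Rightarrow>\<^sub>0 'a, nat) module set) // mpoly_module_iso n m)"

definition iso_class_series :: "'a::{field, finite} itself \<Rightarrow> nat \<Rightarrow> rat fps" where
  "iso_class_series F m = Abs_fps (\<lambda>n. of_nat (num_iso_classes F m n))"

text \<open>
  A power series is rational if it is the quotient of two polynomials. The denominator is
  required to be a unit in the power series ring, since \<open>(/)\<close> on \<^typ>\<open>rat fps\<close>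
  truncates otherwise; over a field this does not restrict the class of power series.
\<close>

definition is_rational_fps :: "'a::field fps \<Rightarrow> bool" where
  "is_rational_fps h \<longleftrightarrow>
    (\<exists>p r :: 'a poly. poly.coeff r 0 \<noteq> 0 \<and> h = fps_of_poly p / fps_of_poly r)"


lemma mpoly_ring_simps [simp]:
  "mult (mpoly_ring n) = (*)" "one (mpoly_ring n) = 1"
  "zero (mpoly_ring n) = 0" "add (mpoly_ring n) = (+)"
  by (simp_all add: mpoly_ring_def)

lemma underlying_vs_simps [simp]:
  "carrier (underlying_vs M) = carrier M" "add (underlying_vs M) = add M"
  "zero (underlying_vs M) = zero M" "smult (underlying_vs M) c v = mpoly_const c \<odot>\<^bsub>M\<^esub> v"
  by (simp_all add: underlying_vs_def)

lemma mpoly_const_carrier [simp]: "mpoly_const c \<in> carrier (mpoly_ring n)"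
  by (auto simp: mpoly_const_def mpoly_ring_def)

lemma mpoly_const_hom:
  "mpoly_const (a + b) = mpoly_const a + mpoly_const b"
  "mpoly_const (a * b) = mpoly_const a * mpoly_const b"
  "mpoly_const 1 = 1"
  by (simp_all add: mpoly_const_def single_add mult_single)

lemma mpoly_ring_cring: "cring (mpoly_ring n :: ((nat \<Rightarrow>\<^sub>0 nat) \<Rightarrow>\<^sub>0 'a::comm_ring_1) ring)"
proof -
  let ?C = "carrier (mpoly_ring n :: ((nat \<Rightarrow>\<^sub>0 nat) \<Rightarrow>\<^sub>0 'a) ring)"
  have add: "p + q \<in> ?C" if "p \<in> ?C" "q \<in> ?C" for p q
    using that Poly_Mapping.keys_add[of p q] by (fastforce simp: mpoly_ring_def)
  have mult: "p * q \<in> ?C" if "p \<in> ?C" "q \<in> ?C" for p q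
  proof -
    have "Poly_Mapping.keys e \<subseteq> {..<n}" if e: "e \<in> Poly_Mapping.keys (p * q)" for e
    proof -
      from e obtain a b where "e = a + b" "a \<in> Poly_Mapping.keys p" "b \<in> Poly_Mapping.keys q"
        using keys_mult[of p q] by blast
      thus ?thesis using \<open>p \<in> ?C\<close> \<open>q \<in> ?C\<close> Poly_Mapping.keys_add[of a b]
        by (fastforce simp: mpoly_ring_def)
    qed
    thus ?thesis by (simp add: mpoly_ring_def)
  qed
  have uminus: "- p \<in> ?C" if "p \<in> ?C" for p
    using that by (simp add: mpoly_ring_def)
  have zero: "0 \<in> ?C" and one: "1 \<in> ?C"
    by (simp_all add: mpoly_ring_def)
  show ?thesis
    by (unfold_locales)
       (auto simp: add mult zero one algebra_simps Units_def intro!: bexI[OF _ uminus])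
qed

lemma underlying_vectorspace:
  fixes M :: "((nat \<Rightarrow>\<^sub>0 nat) \<Rightarrow>\<^sub>0 'a::field, 'v) module"
  assumes "module (mpoly_ring n) M"
  shows "vectorspace class_ring (underlying_vs M)"
proof -
  interpret M: Module.module "mpoly_ring n" M by fact
  have "abelian_group (underlying_vs M)"
  proof (rule abelian_groupI)
    fix x assume "x \<in> carrier (underlying_vs M)"
    thus "\<exists>y\<in>carrier (underlying_vs M). y \<oplus>\<^bsub>underlying_vs M\<^esub> x = \<zero>\<^bsub>underlying_vs M\<^esub>"
      using M.M.l_neg by (auto intro!: bexI[of _ "\<ominus>\<^bsub>M\<^esub> x"])
  qed (auto simp: M.M.a_assoc intro: M.M.a_comm)
  hence "module class_ring (underlying_vs M)"
    using M.smult_l_distr[OF mpoly_const_carrier mpoly_const_carrier]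
      M.smult_assoc1[OF mpoly_const_carrier mpoly_const_carrier] M.smult_one
    by (intro moduleI class_cring.is_cring) (auto simp: mpoly_const_hom M.smult_r_distr)
  thus ?thesis
    by (simp add: vectorspace_def class_field)
qed

lemma module_isomorphic_refl: "module_isomorphic R M M"
  unfolding module_isomorphic_def by (intro bexI[of _ id]) (auto simp: LinearCombinations.module_hom_def)

lemma module_isomorphic_sym:
  assumes "Module.module R M" "module_isomorphic R M N"
  shows "module_isomorphic R N M"
proof -
  interpret M: Module.module R M by fact
  obtain f where f: "f \<in> module_hom R M N" and b: "bij_betw f (carrier M) (carrier N)"
    using assms by (auto simp: module_isomorphic_def)
  let ?g = "inv_into (carrier M) f"
  have g: "?g y \<in> carrier M" "f (?g y) = y" if "y \<in> carrier N" for y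
    using b that by (auto simp: bij_betw_def inv_into_into f_inv_into_f)
  have eq: "?g y = x" if "x \<in> carrier M" "f x = y" for x y
    using b that by (auto simp: bij_betw_def)
  have "?g \<in> module_hom R N M"
    using f unfolding LinearCombinations.module_hom_def by (auto simp: g intro!: eq)
  thus ?thesis
    using bij_betw_inv_into[OF b] by (auto simp: module_isomorphic_def)
qed

lemma module_isomorphic_trans:
  assumes "module_isomorphic R L M" "module_isomorphic R M N"
  shows "module_isomorphic R L N"
proof -
  obtain f g where fg: "f \<in> module_hom R L M" "bij_betw f (carrier L) (carrier M)"
    "g \<in> module_hom R M N" "bij_betw g (carrier M) (carrier N)"
    using assms by (auto simp: module_isomorphic_def)
  hence "g \<circ> f \<in> module_hom R L N"
    by (auto simp: LinearCombinations.module_hom_def Pi_iff)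
  thus ?thesis
    using bij_betw_trans[OF fg(2,4)] by (auto simp: module_isomorphic_def)
qed

lemma equiv_mpoly_module_iso: "equiv (mpoly_modules n m) (mpoly_module_iso n m)"
  by (rule equivI)
     (auto simp: mpoly_module_iso_def refl_on_def sym_def trans_def mpoly_modules_def
        is_mpoly_module_def
      intro: module_isomorphic_refl module_isomorphic_sym module_isomorphic_trans)

lemma is_mpoly_module_isomorphic:
  assumes M: "is_mpoly_module n m M" and N: "Module.module (mpoly_ring n) N"
    and iso: "module_isomorphic (mpoly_ring n) M N"
  shows "is_mpoly_module n m N"
proof -
  obtain f where f: "f \<in> module_hom (mpoly_ring n) M N"
    and b: "bij_betw f (carrier M) (carrier N)"
    using iso by (auto simp: module_isomorphic_def)
  interpret V: vectorspace class_ring "underlying_vs M"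
    using M by (intro underlying_vectorspace[of n]) (simp add: is_mpoly_module_def)
  interpret W: vectorspace class_ring "underlying_vs N"
    using N by (rule underlying_vectorspace)
  have "f \<in> module_hom class_ring (underlying_vs M) (underlying_vs N)"
    using f by (auto simp: LinearCombinations.module_hom_def)
  then interpret T: linear_map class_ring "underlying_vs M" "underlying_vs N" f
    by unfold_locales
  have surj: "f ` carrier (underlying_vs M) = carrier (underlying_vs N)"
    and inj: "inj_on f (carrier (underlying_vs M))"
    using b by (auto simp: bij_betw_def)
  show ?thesis
    using M N T.dim_eq[OF _ inj surj] T.surj_fin_dim[OF _ surj] by (simp add: is_mpoly_module_def)
qed

lemma mpoly_module_finite:
  fixes M :: "((nat \<Rightarrow>\<^sub>0 nat) \<Rightarrow>\<^sub>0 'a::{field, finite}, 'v) module"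
  assumes M: "is_mpoly_module n m M"
  shows "finite (carrier M)"
proof -
  interpret V: vectorspace class_ring "underlying_vs M"
    using M by (intro underlying_vectorspace[of n]) (simp add: is_mpoly_module_def)
  obtain A where A: "finite A" "A \<subseteq> carrier M" "V.span A = carrier M"
    using M by (auto simp: is_mpoly_module_def V.fin_dim_def)
  have "V.lincomb a A = V.lincomb (restrict a A) A" for a
    unfolding V.lincomb_def using A(2)
    by (intro V.M.finsum_cong') (auto intro!: V.smult_closed[simplified])
  hence "V.span A \<subseteq> (\<lambda>a. V.lincomb a A) ` (A \<rightarrow>\<^sub>E UNIV)"
    using A by (subst V.finite_span) (auto intro!: image_eqI[where x = "restrict _ A"])
  moreover have "finite (A \<rightarrow>\<^sub>E (UNIV :: 'a set))"
    using A(1) by (intro finite_PiE) auto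
  ultimately show ?thesis
    using A(3) by (metis finite_imageI finite_subset)
qed

lemma mpoly_module_nat_representative:
  fixes M :: "((nat \<Rightarrow>\<^sub>0 nat) \<Rightarrow>\<^sub>0 'a::{field, finite}, 'v) module"
  assumes M: "is_mpoly_module n m M"
  shows "\<exists>N \<in> mpoly_modules n m. module_isomorphic (mpoly_ring n) M N"
proof -
  interpret M: Module.module "mpoly_ring n" M
    using M by (simp add: is_mpoly_module_def)
  obtain f :: "'v \<Rightarrow> nat" where inj: "inj_on f (carrier M)"
    using finite_imp_inj_to_nat_seg[OF mpoly_module_finite[OF M]] by blast
  define g where "g = inv_into (carrier M) f"
  have g [simp]: "g (f x) = x" if "x \<in> carrier M" for x
    using that inj by (simp add: g_def)
  define N :: "((nat \<Rightarrow>\<^sub>0 nat) \<Rightarrow>\<^sub>0 'a, nat) module" where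
    "N = \<lparr> carrier = f ` carrier M, mult = (\<lambda>_ _. 0), one = 0, zero = f \<zero>\<^bsub>M\<^esub>,
           add = (\<lambda>x y. f (g x \<oplus>\<^bsub>M\<^esub> g y)), smult = (\<lambda>r x. f (r \<odot>\<^bsub>M\<^esub> g x)) \<rparr>"
  have "abelian_group N"
  proof (rule abelian_groupI)
    fix y assume "y \<in> carrier N"
    then obtain x where "x \<in> carrier M" "y = f x" by (auto simp: N_def)
    thus "\<exists>z\<in>carrier N. z \<oplus>\<^bsub>N\<^esub> y = \<zero>\<^bsub>N\<^esub>"
      using M.M.l_neg by (auto simp: N_def intro!: bexI[of _ "\<ominus>\<^bsub>M\<^esub> x"])
  qed (auto simp: N_def M.M.a_ac)
  hence N: "Module.module (mpoly_ring n) N"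
    using M.smult_l_distr M.smult_r_distr M.smult_assoc1 M.smult_one
    by (intro moduleI mpoly_ring_cring) (auto simp: N_def)
  have "f \<in> module_hom (mpoly_ring n) M N"
    by (auto simp: LinearCombinations.module_hom_def N_def)
  hence iso: "module_isomorphic (mpoly_ring n) M N"
    using inj by (auto simp: module_isomorphic_def N_def bij_betw_def)
  show ?thesis
    using is_mpoly_module_isomorphic[OF M N iso] iso by (auto simp: mpoly_modules_def)
qed

end

theory Submission
  imports Defs "HOL-Algebra.Group_Action"
begin

text \<open>
  An \<open>m\<close>-dimensional module over the polynomial ring in \<open>n\<close> variables is an \<open>n\<close>-tuple of
  commuting endomorphisms of a fixed \<open>m\<close>-dimensional space, and isomorphism is simultaneous
  conjugation. By Burnside's lemma the number of orbits is the average, over the invertible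
  endomorphisms \<open>g\<close>, of the number of commuting \<open>n\<close>-tuples in the centraliser of \<open>g\<close>. For a
  finite set \<open>C\<close> let \<open>F C\<close> be the generating function of commuting tuples in \<open>C\<close>. Removing
  the first entry \<open>x\<close> of a tuple leaves a tuple in the centraliser of \<open>x\<close> in \<open>C\<close>, so
  \<open>F C = 1 + t * (\<Sum>x\<in>C. F {y \<in> C. x y = y x})\<close>, and \<open>F C\<close> is rational by induction on \<open>C\<close>.
\<close>

section \<open>Rational power series\<close>

text \<open>Passing to the product equation \<open>h * fps_of_poly r = fps_of_poly p\<close> removes
  the truncating division; the closure lemmas below rest on this form and its converse
  \<open>is_rational_fpsE\<close>.\<close>

lemma is_rational_fpsI:
  assumes "poly.coeff r 0 \<noteq> 0" "h * fps_of_poly r = fps_of_poly p"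
  shows "is_rational_fps h"
  unfolding is_rational_fps_def
proof (intro exI conjI)
  have "fps_of_poly r \<noteq> 0" using assms(1) by (metis fps_of_poly_nth fps_zero_nth)
  thus "h = fps_of_poly p / fps_of_poly r"
    by (metis assms(2) nonzero_mult_div_cancel_right)
qed fact

lemma is_rational_fpsE:
  assumes "is_rational_fps h"
  obtains p r where "poly.coeff r 0 \<noteq> 0" "h * fps_of_poly r = fps_of_poly p"
proof -
  obtain p r where pr: "poly.coeff r 0 \<noteq> 0" "h = fps_of_poly p / fps_of_poly r"
    using assms by (auto simp: is_rational_fps_def)
  have "fps_nth (fps_of_poly r) 0 \<noteq> 0" using pr(1) by simp
  hence "is_unit (fps_of_poly r)" by (simp add: fps_is_unit_iff)
  hence "h * fps_of_poly r = fps_of_poly p" unfolding pr(2) by simp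
  with pr(1) show thesis by (rule that)
qed

lemma is_rational_fps_of_poly: "is_rational_fps (fps_of_poly p)"
  by (rule is_rational_fpsI[of 1]) auto

lemma is_rational_fps_add:
  assumes "is_rational_fps f" "is_rational_fps g"
  shows "is_rational_fps (f + g)"
proof -
  obtain p r where f: "poly.coeff r 0 \<noteq> 0" "f * fps_of_poly r = fps_of_poly p"
    using assms(1) by (rule is_rational_fpsE)
  obtain q s where g: "poly.coeff s 0 \<noteq> 0" "g * fps_of_poly s = fps_of_poly q"
    using assms(2) by (rule is_rational_fpsE)
  have "(f + g) * fps_of_poly (r * s) = fps_of_poly (p * s + q * r)"
    by (simp add: fps_of_poly_mult fps_of_poly_add flip: f(2) g(2)) (simp add: algebra_simps)
  thus ?thesis by (rule is_rational_fpsI[rotated]) (simp add: coeff_mult f g)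
qed

lemma is_rational_fps_mult:
  assumes "is_rational_fps f" "is_rational_fps g"
  shows "is_rational_fps (f * g)"
proof -
  obtain p r where f: "poly.coeff r 0 \<noteq> 0" "f * fps_of_poly r = fps_of_poly p"
    using assms(1) by (rule is_rational_fpsE)
  obtain q s where g: "poly.coeff s 0 \<noteq> 0" "g * fps_of_poly s = fps_of_poly q"
    using assms(2) by (rule is_rational_fpsE)
  have "(f * g) * fps_of_poly (r * s) = fps_of_poly (p * q)"
    by (simp add: fps_of_poly_mult flip: f(2) g(2))
  thus ?thesis by (rule is_rational_fpsI[rotated]) (simp add: coeff_mult f g)
qed

lemma is_rational_fps_sum:
  assumes "\<And>x. x \<in> A \<Longrightarrow> is_rational_fps (f x)"
  shows "is_rational_fps (\<Sum>x\<in>A. f x)"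
  using assms
proof (induction A rule: infinite_finite_induct)
  case (insert x A)
  thus ?case by (simp add: is_rational_fps_add)
qed (use is_rational_fps_of_poly[of 0] in auto)

text \<open>Serves to solve a linear equation for \<open>h\<close> once its multiples have been
  collected into one polynomial factor.\<close>

lemma is_rational_fps_cancel:
  assumes "poly.coeff r 0 \<noteq> 0" "is_rational_fps (h * fps_of_poly r)"
  shows "is_rational_fps h"
proof -
  obtain p s where "poly.coeff s 0 \<noteq> 0" "h * fps_of_poly r * fps_of_poly s = fps_of_poly p"
    using assms(2) by (rule is_rational_fpsE)
  thus ?thesis
    using assms(1)
    by (intro is_rational_fpsI[of "r * s" _ p]) (simp_all add: coeff_mult fps_of_poly_mult mult.assoc)
qed

section \<open>Tuples of pairwise related elements\<close>

text \<open>The relation stays abstract, so that passing from \<open>C\<close> to the elements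
  related to \<open>x\<close> changes only the set and the recursion stays inside one
  family.\<close>

definition related_lists :: "('e \<Rightarrow> 'e \<Rightarrow> bool) \<Rightarrow> 'e set \<Rightarrow> nat \<Rightarrow> 'e list set" where
  "related_lists R C n =
    {xs. length xs = n \<and> set xs \<subseteq> C \<and> (\<forall>x \<in> set xs. \<forall>y \<in> set xs. R x y)}"

lemma finite_related_lists: "finite C \<Longrightarrow> finite (related_lists R C n)"
  unfolding related_lists_def
  by (rule finite_subset[OF _ finite_lists_length_eq[of C n]]) auto

lemma related_lists_0 [simp]: "related_lists R C 0 = {[]}"
  by (auto simp: related_lists_def)

text \<open>The tail after a head \<open>x\<close> must lie among the elements related to
  \<open>x\<close>. Conversely, reflexivity supplies the pair \<open>(x, x)\<close> and symmetry the
  pairs \<open>(y, x)\<close>.\<close>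

lemma related_lists_Suc:
  assumes "\<And>x. x \<in> C \<Longrightarrow> R x x" "symp R"
  shows "related_lists R C (Suc n) =
    (\<Union>x\<in>C. (#) x ` related_lists R {y \<in> C. R x y} n)"
proof (intro equalityI subsetI)
  fix xs assume "xs \<in> related_lists R C (Suc n)"
  thus "xs \<in> (\<Union>x\<in>C. (#) x ` related_lists R {y \<in> C. R x y} n)"
    by (cases xs) (auto simp: related_lists_def image_iff subset_iff)
next
  fix xs assume "xs \<in> (\<Union>x\<in>C. (#) x ` related_lists R {y \<in> C. R x y} n)"
  then obtain x ys where "xs = x # ys" "x \<in> C" "ys \<in> related_lists R {y \<in> C. R x y} n"
    by blast
  moreover from this have "R x x" "\<forall>y \<in> set ys. R x y \<and> R y x"
    using assms by (auto simp: related_lists_def dest: sympD)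
  ultimately show "xs \<in> related_lists R C (Suc n)"
    by (auto simp: related_lists_def)
qed

lemma card_related_lists_Suc:
  assumes "\<And>x. x \<in> C \<Longrightarrow> R x x" "symp R" "finite C"
  shows "card (related_lists R C (Suc n)) = (\<Sum>x\<in>C. card (related_lists R {y \<in> C. R x y} n))"
proof -
  have "card (related_lists R C (Suc n)) =
      (\<Sum>x\<in>C. card ((#) x ` related_lists R {y \<in> C. R x y} n))"
    \<comment> \<open>The union is disjoint because lists with different heads differ.\<close>
    using related_lists_Suc[of C R, OF assms(1,2)] assms(3)
    by (subst card_UN_disjoint[symmetric]) (auto simp: finite_related_lists)
  thus ?thesis by (simp add: card_image)
qed

definition related_series :: "('e \<Rightarrow> 'e \<Rightarrow> bool) \<Rightarrow> 'e set \<Rightarrow> rat fps" where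
  "related_series R C = Abs_fps (\<lambda>n. of_nat (card (related_lists R C n)))"

text \<open>Coefficientwise this is \<open>card_related_lists_Suc\<close>: \<open>fps_X\<close>
  shifts the index by one, and the summand 1 counts the empty list.\<close>

lemma related_series_eq:
  assumes "\<And>x. x \<in> C \<Longrightarrow> R x x" "symp R" "finite C"
  shows "related_series R C = 1 + fps_X * (\<Sum>x\<in>C. related_series R {y \<in> C. R x y})"
proof (rule fps_ext)
  fix n
  show "fps_nth (related_series R C) n =
      fps_nth (1 + fps_X * (\<Sum>x\<in>C. related_series R {y \<in> C. R x y})) n"
  proof (cases n)
    case (Suc k)
    have "card (related_lists R C (Suc k)) = (\<Sum>x\<in>C. card (related_lists R {y \<in> C. R x y} k))"
      by (rule card_related_lists_Suc[OF assms])
    thus ?thesis by (simp add: Suc related_series_def fps_sum_nth)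
  qed (simp add: related_series_def)
qed

text \<open>
  The elements related to everything in \<open>C\<close> contribute \<open>fps_X * related_series R C\<close> each,
  the others a series for a strictly smaller set.
\<close>

lemma is_rational_related_series:
  assumes "finite C" "\<And>x. x \<in> C \<Longrightarrow> R x x" "symp R"
  shows "is_rational_fps (related_series R C)"
  using assms(1,2)
proof (induction C rule: finite_psubset_induct)
  case (psubset C)
  define Z where "Z = {x \<in> C. \<forall>y \<in> C. R x y}"
  let ?g = "\<lambda>x. related_series R {y \<in> C. R x y}" and ?h = "related_series R C"
  have ZC: "Z \<subseteq> C" "finite Z" using psubset.hyps by (auto simp: Z_def)
  have "?g x = ?h" if "x \<in> Z" for x
    using that by (intro arg_cong[of _ _ "related_series R"]) (auto simp: Z_def)
  hence "(\<Sum>x\<in>C. ?g x) = (\<Sum>x\<in>C - Z. ?g x) + of_nat (card Z) * ?h"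
    using sum.subset_diff[OF ZC(1) psubset.hyps, of ?g] by simp
  moreover have "?h = 1 + fps_X * (\<Sum>x\<in>C. ?g x)"
    by (rule related_series_eq[OF psubset.prems assms(3) psubset.hyps])
  ultimately have "?h = 1 + fps_X * ((\<Sum>x\<in>C - Z. ?g x) + of_nat (card Z) * ?h)"
    by metis
  hence "?h - ?h * (of_nat (card Z) * fps_X) = 1 + fps_X * (\<Sum>x\<in>C - Z. ?g x)"
    by (simp add: algebra_simps)
  \<comment> \<open>The multiples of \<open>?h\<close> collect into the factor 1 - |Z| t, whose
    constant coefficient 1 permits the final cancellation.\<close>
  moreover have "fps_of_poly [:1, - of_nat (card Z) :: rat:] = 1 - of_nat (card Z) * fps_X"
    by (simp add: fps_of_poly_pCons fps_of_nat mult.commute flip: fps_const_neg)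
  ultimately have eq: "?h * fps_of_poly [:1, - of_nat (card Z):] =
      1 + fps_X * (\<Sum>x\<in>C - Z. ?g x)"
    by (simp add: right_diff_distrib)
  have "is_rational_fps (?g x)" if "x \<in> C - Z" for x
    using that psubset.prems by (intro psubset.IH) (auto simp: Z_def)
  hence "is_rational_fps (\<Sum>x\<in>C - Z. ?g x)" by (rule is_rational_fps_sum)
  hence "is_rational_fps (1 + fps_X * (\<Sum>x\<in>C - Z. ?g x))"
    using is_rational_fps_of_poly[of 1] is_rational_fps_of_poly[of "[:0, 1:]"]
    by (intro is_rational_fps_add is_rational_fps_mult) (simp_all add: fps_of_poly_pCons)
  hence "is_rational_fps (?h * fps_of_poly [:1, - of_nat (card Z):])"
    by (simp only: eq)
  thus ?case
    by (rule is_rational_fps_cancel[rotated]) simp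
qed

section \<open>Simultaneous conjugation in a monoid\<close>

context monoid
begin

definition commuting_lists :: "'a set \<Rightarrow> nat \<Rightarrow> 'a list set" where
  "commuting_lists C = related_lists (\<lambda>x y. x \<otimes> y = y \<otimes> x) C"

lemma finite_commuting_lists: "finite C \<Longrightarrow> finite (commuting_lists C n)"
  by (simp add: commuting_lists_def finite_related_lists)

definition conjugate :: "'a \<Rightarrow> 'a \<Rightarrow> 'a" where
  "conjugate g x = g \<otimes> x \<otimes> inv g"

text \<open>The \<open>restrict\<close> makes each map extensional, as the elements of
  \<open>BijGroup\<close> must be.\<close>

definition conj_action :: "nat \<Rightarrow> 'a \<Rightarrow> 'a list \<Rightarrow> 'a list" where
  "conj_action n g = restrict (map (conjugate g)) (commuting_lists (carrier G) n)"

lemma Units_cancel [simp]: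
  assumes "g \<in> Units G" "x \<in> carrier G"
  shows "inv g \<otimes> (g \<otimes> x) = x" "g \<otimes> (inv g \<otimes> x) = x"
  using assms by (simp_all add: Units_closed flip: m_assoc)

lemma conjugate_closed [simp]: "g \<in> Units G \<Longrightarrow> x \<in> carrier G \<Longrightarrow> conjugate g x \<in> carrier G"
  by (simp add: conjugate_def Units_closed)

text \<open>The form without inverses describes fixed points as commuting elements and later matches
  the intertwining condition for module isomorphisms.\<close>

lemma conjugate_eq_iff:
  assumes "g \<in> Units G" "x \<in> carrier G" "y \<in> carrier G"
  shows "conjugate g x = y \<longleftrightarrow> g \<otimes> x = y \<otimes> g"
proof
  assume "conjugate g x = y"
  thus "g \<otimes> x = y \<otimes> g" using assms by (auto simp: conjugate_def m_assoc Units_closed)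
next
  assume "g \<otimes> x = y \<otimes> g"
  thus "conjugate g x = y" using assms by (simp add: conjugate_def m_assoc Units_closed)
qed

lemma conjugate_mult:
  assumes "g \<in> Units G" "x \<in> carrier G" "y \<in> carrier G"
  shows "conjugate g (x \<otimes> y) = conjugate g x \<otimes> conjugate g y"
  using assms by (simp add: conjugate_def m_assoc Units_closed)

lemma conjugate_conjugate:
  assumes "g \<in> Units G" "h \<in> Units G" "x \<in> carrier G"
  shows "conjugate (g \<otimes> h) x = conjugate g (conjugate h x)"
proof -
  have "inv (g \<otimes> h) = inv h \<otimes> inv g"
    using assms by (intro inv_unique'[symmetric]) (auto simp: m_assoc Units_closed)
  thus ?thesis using assms by (simp add: conjugate_def m_assoc Units_closed)
qed

lemma conjugate_one [simp]: "x \<in> carrier G \<Longrightarrow> conjugate \<one> x = x"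
  by (simp add: conjugate_eq_iff)

lemma map_conjugate_commuting_lists:
  assumes "g \<in> Units G" "xs \<in> commuting_lists (carrier G) n"
  shows "map (conjugate g) xs \<in> commuting_lists (carrier G) n"
proof -
  have "conjugate g x \<otimes> conjugate g y = conjugate g y \<otimes> conjugate g x"
    if "x \<in> carrier G" "y \<in> carrier G" "x \<otimes> y = y \<otimes> x" for x y
    using that assms(1) by (metis conjugate_mult)
  thus ?thesis
    using assms by (auto simp: commuting_lists_def related_lists_def subset_iff)
qed

lemma commuting_listsD:
  assumes "xs \<in> commuting_lists C n"
  shows "length xs = n" "x \<in> set xs \<Longrightarrow> x \<in> C"
  using assms by (auto simp: commuting_lists_def related_lists_def)

lemma map_conjugate_conjugate:
  assumes "g \<in> Units G" "h \<in> Units G" "xs \<in> commuting_lists (carrier G) n"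
  shows "map (conjugate g) (map (conjugate h) xs) = map (conjugate (g \<otimes> h)) xs"
  using assms by (auto simp: conjugate_conjugate dest: commuting_listsD)

lemma group_action_conj_action:
  "group_action (units_of G) (commuting_lists (carrier G) n) (conj_action n)"
proof -
  let ?T = "commuting_lists (carrier G) n"
  have inv: "map (conjugate g) (map (conjugate (inv g)) xs) = xs"
    "map (conjugate (inv g)) (map (conjugate g) xs) = xs"
    if "g \<in> Units G" "xs \<in> ?T" for g xs
    using that by (auto simp: map_conjugate_conjugate simp del: map_map
          dest: commuting_listsD(2) intro!: map_idI)
  have "bij_betw (map (conjugate g)) ?T ?T" if "g \<in> Units G" for g
    using that inv[OF that] by (intro bij_betwI[of _ _ _ "map (conjugate (inv g))"])
      (auto intro: map_conjugate_commuting_lists simp del: map_map)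
  hence bij: "conj_action n g \<in> Bij ?T" if "g \<in> Units G" for g
    using that by (auto simp: Bij_def conj_action_def bij_betw_def inj_on_def)
  have "conj_action n (g \<otimes> h) = compose ?T (conj_action n g) (conj_action n h)"
    if "g \<in> Units G" "h \<in> Units G" for g h
    using that by (auto simp: conj_action_def compose_def fun_eq_iff map_conjugate_commuting_lists
       map_conjugate_conjugate simp del: map_map)
  with bij have "conj_action n \<in> hom (units_of G) (BijGroup ?T)"
    by (auto simp: hom_def BijGroup_def units_of_def)
  thus ?thesis
    by (simp add: group_action_def group_hom_def group_hom_axioms_def units_group group_BijGroup)
qed

text \<open>Conjugation by \<open>g\<close> fixes a list exactly if it fixes every entry, that is,
  if every entry commutes with \<open>g\<close>. This identifies the fixed points in Burnside's
  formula.\<close>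

lemma invariants_conj_action:
  assumes "g \<in> Units G"
  shows "invariants (commuting_lists (carrier G) n) (conj_action n) g =
    commuting_lists {x \<in> carrier G. g \<otimes> x = x \<otimes> g} n"
proof -
  have "map (conjugate g) xs = xs \<longleftrightarrow> set xs \<subseteq> {x \<in> carrier G. g \<otimes> x = x \<otimes> g}"
    if "set xs \<subseteq> carrier G" for xs
    using that assms by (induction xs) (auto simp: conjugate_eq_iff)
  thus ?thesis
    by (auto simp: invariants_def conj_action_def commuting_lists_def related_lists_def)
qed

text \<open>The order of the unit group does not depend on \<open>n\<close>, so Burnside's formula
  for all \<open>n\<close> at once writes the series as a constant times a finite sum of rational
  series, one per centraliser.\<close>

lemma rational_orbits_commuting_lists:
  assumes "finite (carrier G)"
  shows "is_rational_fps (Abs_fps (\<lambda>n. of_nat (card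
    (orbits (units_of G) (commuting_lists (carrier G) n) (conj_action n))) :: rat))"
proof -
  let ?c = "\<lambda>n. card (orbits (units_of G) (commuting_lists (carrier G) n) (conj_action n))"
  let ?Z = "\<lambda>g. {x \<in> carrier G. g \<otimes> x = x \<otimes> g}"
  let ?S = "\<lambda>g. related_series (\<lambda>x y. x \<otimes> y = y \<otimes> x) (?Z g)"
  have U: "finite (Units G)" "Units G \<noteq> {}"
    using assms by (auto intro: finite_subset[OF _ assms])
  have "?c n * card (Units G) = (\<Sum>g\<in>Units G. card (commuting_lists (?Z g) n))" for n
    using group_action.burnside[OF group_action_conj_action, of n] U(1)
      finite_commuting_lists[OF assms, of n]
    by (simp add: Coset.order_def units_of_carrier invariants_conj_action)
  hence "of_nat (?c n) =
      (\<Sum>g\<in>Units G. of_nat (card (commuting_lists (?Z g) n))) / (of_nat (card (Units G)) :: rat)"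
    for n
    using U by (subst eq_divide_eq) (simp flip: of_nat_mult of_nat_sum)
  hence "Abs_fps (\<lambda>n. of_nat (?c n)) = fps_const (1 / of_nat (card (Units G))) * (\<Sum>g\<in>Units G. ?S g)"
    by (intro fps_ext) (simp add: related_series_def fps_sum_nth commuting_lists_def)
  moreover have "is_rational_fps (?S g)" for g
    using assms by (intro is_rational_related_series) (auto intro: sympI)
  moreover have "is_rational_fps (fps_const (1 / of_nat (card (Units G))) :: rat fps)"
    using is_rational_fps_of_poly[of "[:1 / of_nat (card (Units G)):]"]
    by (simp add: fps_of_poly_const)
  ultimately show ?thesis
    by (simp only: is_rational_fps_mult is_rational_fps_sum)
qed

end

section \<open>Polynomial actions of commuting endomorphisms\<close>

definition mpoly_var :: "nat \<Rightarrow> (nat \<Rightarrow>\<^sub>0 nat) \<Rightarrow>\<^sub>0 'a::comm_ring_1" where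
  "mpoly_var i = Poly_Mapping.single (Poly_Mapping.single i 1) 1"

lemma mpoly_var_carrier [simp]: "i < n \<Longrightarrow> mpoly_var i \<in> carrier (mpoly_ring n)"
  by (auto simp: mpoly_var_def mpoly_ring_def)

text \<open>Turns the step of \<open>update_induct\<close> into an addition.\<close>

lemma update_eq_add:
  fixes f :: "'k \<Rightarrow>\<^sub>0 'b::monoid_add"
  assumes "a \<notin> Poly_Mapping.keys f"
  shows "Poly_Mapping.update a b f = f + Poly_Mapping.single a b"
  using assms
  by (intro poly_mapping_eqI)
     (auto simp: lookup_update lookup_add lookup_single when_def in_keys_iff)

lemma mpoly_mult_closed:
  "p \<in> carrier (mpoly_ring n) \<Longrightarrow> q \<in> carrier (mpoly_ring n) \<Longrightarrow> p * q \<in> carrier (mpoly_ring n)"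
  using cring.cring_simprules(5)[OF mpoly_ring_cring] by simp

text \<open>Constants and variables generate the ring: a polynomial is a sum of constants times
  monomials, and a monomial is a product of powers of variables.\<close>

lemma mpoly_ring_induct [consumes 1, case_names const var add mult]:
  fixes p :: "(nat \<Rightarrow>\<^sub>0 nat) \<Rightarrow>\<^sub>0 'a::comm_ring_1"
  assumes p: "p \<in> carrier (mpoly_ring n)"
    and const: "\<And>c. P (mpoly_const c)"
    and var: "\<And>i. i < n \<Longrightarrow> P (mpoly_var i)"
    and add: "\<And>p q. p \<in> carrier (mpoly_ring n) \<Longrightarrow> q \<in> carrier (mpoly_ring n) \<Longrightarrow>
      P p \<Longrightarrow> P q \<Longrightarrow> P (p + q)"
    and mult: "\<And>p q. p \<in> carrier (mpoly_ring n) \<Longrightarrow> q \<in> carrier (mpoly_ring n) \<Longrightarrow>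
      P p \<Longrightarrow> P q \<Longrightarrow> P (p * q)"
  shows "P p"
proof -
  \<comment> \<open>Membership in the ring is carried along with \<open>P\<close>, since the
    hypotheses \<open>add\<close> and \<open>mult\<close> demand it.\<close>
  let ?Q = "\<lambda>p. p \<in> carrier (mpoly_ring n) \<and> P p"
  have Qmult: "?Q (p * q)" if "?Q p" "?Q q" for p q
    using that mult mpoly_mult_closed by blast
  have one: "?Q 1"
    using const[of 1] mpoly_const_carrier[of 1 n] by (simp add: mpoly_const_hom)
  have pow: "?Q (mpoly_var i ^ k)" if "i < n" for i k
    using that var Qmult one by (induction k) auto
  have mon: "?Q (Poly_Mapping.single e 1)" if "Poly_Mapping.keys e \<subseteq> {..<n}" for e
    using that
  proof (induction e rule: update_induct)
    case const
    show ?case using one by simp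
  next
    case (update e i k)
    have "mpoly_var i ^ k = (Poly_Mapping.single (Poly_Mapping.single i k) 1 :: _ \<Rightarrow>\<^sub>0 'a)" for k
      by (induction k) (simp_all add: mpoly_var_def mult_single flip: single_add)
    hence "Poly_Mapping.single (Poly_Mapping.update i k e) (1 :: 'a) =
        Poly_Mapping.single e 1 * mpoly_var i ^ k"
      using update by (simp add: update_eq_add mult_single)
    thus ?case
      using update Qmult pow by (simp add: keys_update)
  qed
  have "p \<in> carrier (mpoly_ring n) \<Longrightarrow> P p"
  proof (induction p rule: update_induct)
    case const
    show ?case using assms(2)[of 0] by (simp add: mpoly_const_def)
  next
    case (update p e c)
    have "Poly_Mapping.single e c = mpoly_const c * Poly_Mapping.single e 1"
      by (simp add: mpoly_const_def mult_single)
    moreover have "Poly_Mapping.keys e \<subseteq> {..<n}" "p \<in> carrier (mpoly_ring n)"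
      using update by (auto simp: mpoly_ring_def keys_update)
    ultimately show ?case
      using update mon[of e] Qmult[of "mpoly_const c"] const[of c] add
      by (simp add: update_eq_add)
  qed
  thus ?thesis using p by blast
qed

text \<open>An additive map that respects the action of the generators also respects that of their
  sums and products, hence of every polynomial.\<close>

lemma module_hom_mpoly_ringI:
  fixes M :: "((nat \<Rightarrow>\<^sub>0 nat) \<Rightarrow>\<^sub>0 'a::comm_ring_1, 'v, 'd) module_scheme"
    and N :: "((nat \<Rightarrow>\<^sub>0 nat) \<Rightarrow>\<^sub>0 'a::comm_ring_1, 'w, 'e) module_scheme"
  assumes "Module.module (mpoly_ring n) M" "Module.module (mpoly_ring n) N"
    and closed: "\<And>v. v \<in> carrier M \<Longrightarrow> f v \<in> carrier N"
    and add: "\<And>v w. v \<in> carrier M \<Longrightarrow> w \<in> carrier M \<Longrightarrow> f (v \<oplus>\<^bsub>M\<^esub> w) = f v \<oplus>\<^bsub>N\<^esub> f w"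
    and const: "\<And>c v. v \<in> carrier M \<Longrightarrow> f (mpoly_const c \<odot>\<^bsub>M\<^esub> v) = mpoly_const c \<odot>\<^bsub>N\<^esub> f v"
    and var: "\<And>i v. i < n \<Longrightarrow> v \<in> carrier M \<Longrightarrow> f (mpoly_var i \<odot>\<^bsub>M\<^esub> v) = mpoly_var i \<odot>\<^bsub>N\<^esub> f v"
  shows "f \<in> module_hom (mpoly_ring n) M N"
proof -
  interpret M: Module.module "mpoly_ring n" M by fact
  interpret N: Module.module "mpoly_ring n" N by fact
  have "\<forall>v \<in> carrier M. f (p \<odot>\<^bsub>M\<^esub> v) = p \<odot>\<^bsub>N\<^esub> f v" if "p \<in> carrier (mpoly_ring n)" for p
    using that
  proof (induction rule: mpoly_ring_induct)
    case (add p q)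
    thus ?case
      using M.smult_l_distr[of p q] N.smult_l_distr[of p q] by (simp add: closed assms(4))
  next
    case (mult p q)
    thus ?case
      using M.smult_assoc1[of p q] N.smult_assoc1[of p q] by (simp add: closed)
  qed (simp_all add: const var)
  thus ?thesis
    using closed add by (auto simp: LinearCombinations.module_hom_def)
qed

section \<open>The model space of polynomials of degree below \<open>m\<close> and its
  endomorphisms\<close>

lemma poly_cutoff_add: "poly_cutoff m (p + q) = poly_cutoff m p + poly_cutoff m q"
  by (simp add: poly_eq_iff coeff_poly_cutoff)

lemma poly_cutoff_smult:
  "poly_cutoff m (Polynomial.smult c p) = Polynomial.smult c (poly_cutoff m p)"
  by (simp add: poly_eq_iff coeff_poly_cutoff)

lemma poly_cutoff_idem [simp]: "poly_cutoff m (poly_cutoff m p) = poly_cutoff m p"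
  by (simp add: poly_eq_iff coeff_poly_cutoff)

text \<open>These are the polynomials of degree below \<open>m\<close>, a concrete
  \<open>m\<close>-dimensional space with the coefficients as coordinates.\<close>

definition small_polys :: "nat \<Rightarrow> 'a::zero poly set" where
  "small_polys m = {p. poly_cutoff m p = p}"

lemma small_polys_iff: "p \<in> small_polys m \<longleftrightarrow> (\<forall>i\<ge>m. poly.coeff p i = 0)"
  by (auto simp: small_polys_def poly_eq_iff coeff_poly_cutoff not_less)

lemma small_polys_closed [simp]:
  "0 \<in> small_polys m" "poly_cutoff m p \<in> small_polys m"
  "p \<in> small_polys m \<Longrightarrow> q \<in> small_polys m \<Longrightarrow> p + q \<in> small_polys m"
  "p \<in> small_polys m \<Longrightarrow> - p \<in> small_polys m"
  "p \<in> small_polys m \<Longrightarrow> Polynomial.smult c p \<in> small_polys m"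
  by (auto simp: small_polys_iff coeff_poly_cutoff)

lemma poly_cutoff_small [simp]: "p \<in> small_polys m \<Longrightarrow> poly_cutoff m p = p"
  by (simp add: small_polys_def)

lemma finite_small_polys: "finite (small_polys m :: 'a::{comm_monoid_add, finite} poly set)"
proof (rule finite_surj)
  show "finite ({..<m} \<rightarrow>\<^sub>E (UNIV :: 'a set))" by (intro finite_PiE) auto
  show "small_polys m \<subseteq> (\<lambda>a. \<Sum>i<m. monom (a i) i) ` ({..<m} \<rightarrow>\<^sub>E (UNIV :: 'a set))"
  proof
    fix p :: "'a poly" assume "p \<in> small_polys m"
    hence "p = (\<Sum>i<m. monom (restrict (poly.coeff p) {..<m} i) i)"
      by (auto simp: poly_eq_iff coeff_sum small_polys_iff not_less)
    thus "p \<in> (\<lambda>a. \<Sum>i<m. monom (a i) i) ` ({..<m} \<rightarrow>\<^sub>E UNIV)"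
      by (rule image_eqI[of _ _ "restrict (poly.coeff p) {..<m}"]) simp
  qed
qed

text \<open>
  Endomorphisms of the space of polynomials of degree less than \<open>m\<close>, extended to all
  polynomials through \<open>poly_cutoff m\<close> so that composition needs no side conditions.
\<close>

definition poly_endos :: "nat \<Rightarrow> ('a::comm_ring_1 poly \<Rightarrow> 'a poly) set" where
  "poly_endos m = {f.
    (\<forall>p q. f (p + q) = f p + f q) \<and>
    (\<forall>c p. f (Polynomial.smult c p) = Polynomial.smult c (f p)) \<and>
    (\<forall>p. f p \<in> small_polys m) \<and> (\<forall>p. f (poly_cutoff m p) = f p)}"

lemma poly_endosD:
  assumes "f \<in> poly_endos m"
  shows "f (p + q) = f p + f q" "f (Polynomial.smult c p) = Polynomial.smult c (f p)"
    "f p \<in> small_polys m" "f (poly_cutoff m p) = f p"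
  using assms by (auto simp: poly_endos_def)

text \<open>Since \<open>f (poly_cutoff m p) = f p\<close>, an endomorphism is determined by its
  restriction to \<open>small_polys m\<close>, a self-map of a finite set.\<close>

lemma finite_poly_endos: "finite (poly_endos m :: ('a::{comm_ring_1, finite} poly \<Rightarrow> 'a poly) set)"
proof (rule inj_on_finite)
  let ?W = "small_polys m :: 'a poly set"
  show "inj_on (\<lambda>f. restrict f ?W) (poly_endos m)"
  proof (rule inj_onI, rule ext)
    fix f g :: "'a poly \<Rightarrow> 'a poly" and p
    assume "f \<in> poly_endos m" "g \<in> poly_endos m" "restrict f ?W = restrict g ?W"
    thus "f p = g p"
      by (metis poly_endosD(4) restrict_apply' small_polys_closed(2))
  qed
  show "(\<lambda>f. restrict f ?W) ` poly_endos m \<subseteq> ?W \<rightarrow>\<^sub>E ?W"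
    by (auto simp: poly_endosD)
  show "finite (?W \<rightarrow>\<^sub>E ?W)"
    by (intro finite_PiE finite_small_polys)
qed

text \<open>The unit is \<open>poly_cutoff m\<close> because \<open>id\<close> has values outside
  \<open>small_polys m\<close> and so is not in \<open>poly_endos m\<close>.\<close>

definition endo_monoid :: "nat \<Rightarrow> ('a::comm_ring_1 poly \<Rightarrow> 'a poly) monoid" where
  "endo_monoid m = \<lparr> carrier = poly_endos m, mult = (\<circ>), one = poly_cutoff m \<rparr>"

lemma endo_monoid_simps [simp]:
  "carrier (endo_monoid m) = poly_endos m" "mult (endo_monoid m) = (\<circ>)"
  "one (endo_monoid m) = poly_cutoff m"
  by (simp_all add: endo_monoid_def)

lemma monoid_endo_monoid: "Group.monoid (endo_monoid m)"
  by (intro monoidI)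
     (auto simp: poly_endos_def poly_cutoff_add poly_cutoff_smult fun_eq_iff)

section \<open>Monomials evaluated at commuting maps\<close>

primrec monomial_action :: "('v \<Rightarrow> 'v) list \<Rightarrow> nat \<Rightarrow> (nat \<Rightarrow>\<^sub>0 nat) \<Rightarrow> 'v \<Rightarrow> 'v" where
  "monomial_action fs 0 e = id"
| "monomial_action fs (Suc k) e =
    monomial_action fs k e \<circ> ((fs ! k) ^^ Poly_Mapping.lookup e k)"

lemma comp_funpow_commute: "f \<circ> g = g \<circ> f \<Longrightarrow> f \<circ> (g ^^ n) = (g ^^ n) \<circ> f"
  by (induction n) (auto simp: fun_eq_iff)

lemma monomial_action_commute:
  assumes "\<And>i. i < k \<Longrightarrow> f \<circ> fs ! i = fs ! i \<circ> f"
  shows "f \<circ> monomial_action fs k e = monomial_action fs k e \<circ> f"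
  using assms
proof (induction k)
  case (Suc k)
  have "f \<circ> (fs ! k) ^^ j = (fs ! k) ^^ j \<circ> f" for j
    by (intro comp_funpow_commute Suc.prems) simp
  moreover have "f \<circ> monomial_action fs k e = monomial_action fs k e \<circ> f"
    by (intro Suc.IH Suc.prems) simp
  ultimately show ?case by (simp add: fun_eq_iff)
qed simp

lemma monomial_action_add:
  assumes "\<And>i j. i < k \<Longrightarrow> j < k \<Longrightarrow> fs ! i \<circ> fs ! j = fs ! j \<circ> fs ! i"
  shows "monomial_action fs k (a + b) = monomial_action fs k a \<circ> monomial_action fs k b"
  using assms
proof (induction k)
  case (Suc k)
  \<comment> \<open>After the exponents are split, the part of \<open>b\<close> in the earlier maps
    has to move past the power of \<open>fs ! k\<close> coming from \<open>a\<close>.\<close>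
  have "monomial_action fs k b \<circ> fs ! k = fs ! k \<circ> monomial_action fs k b"
    by (intro monomial_action_commute[symmetric] Suc.prems) simp_all
  hence "monomial_action fs k b \<circ> (fs ! k) ^^ j = (fs ! k) ^^ j \<circ> monomial_action fs k b" for j
    by (rule comp_funpow_commute)
  moreover have "monomial_action fs k (a + b) = monomial_action fs k a \<circ> monomial_action fs k b"
    by (intro Suc.IH Suc.prems) simp_all
  ultimately show ?case by (simp add: fun_eq_iff lookup_add funpow_add)
qed simp

lemma monomial_action_id:
  "(\<And>i. i < k \<Longrightarrow> Poly_Mapping.lookup e i = 0) \<Longrightarrow> monomial_action fs k e = id"
  by (induction k) auto

lemma monomial_action_single:
  "i < k \<Longrightarrow> monomial_action fs k (Poly_Mapping.single i 1) = fs ! i"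
proof (induction k)
  case (Suc k)
  show ?case
  proof (cases "i = k")
    case True
    thus ?thesis by (simp add: monomial_action_id lookup_single)
  next
    case False
    thus ?thesis using Suc by (simp add: lookup_single)
  qed
qed simp

lemma monomial_action_invariant:
  assumes "\<And>i v. i < k \<Longrightarrow> v \<in> S \<Longrightarrow> (fs ! i) v \<in> S" "v \<in> S"
  shows "monomial_action fs k e v \<in> S"
  using assms
proof (induction k arbitrary: v)
  case (Suc k)
  have "((fs ! k) ^^ j) v \<in> S" for j
    using Suc.prems by (induction j) auto
  thus ?case using Suc by simp
qed simp

text \<open>Applied below with multiplication by a scalar as \<open>f\<close>.\<close>

lemma monomial_action_hom:
  assumes "\<And>i. i < k \<Longrightarrow> f \<circ> fs ! i = fs ! i \<circ> f"
  shows "monomial_action fs k e (f v) = f (monomial_action fs k e v)"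
  using monomial_action_commute[of k f fs e] assms by (simp add: fun_eq_iff)

lemma monomial_action_additive:
  fixes v w :: "'v::plus"
  assumes "\<And>i v w. i < k \<Longrightarrow> (fs ! i) (v + w) = (fs ! i) v + (fs ! i) w"
  shows "monomial_action fs k e (v + w) = monomial_action fs k e v + monomial_action fs k e w"
  using assms
proof (induction k arbitrary: v w)
  case (Suc k)
  have "((fs ! k) ^^ j) (v + w) = ((fs ! k) ^^ j) v + ((fs ! k) ^^ j) w" for j
    using Suc.prems by (induction j) auto
  thus ?case using Suc by simp
qed simp

section \<open>Polynomials evaluated at commuting endomorphisms\<close>

definition mpoly_action ::
    "('a::comm_ring_1 poly \<Rightarrow> 'a poly) list \<Rightarrow> ((nat \<Rightarrow>\<^sub>0 nat) \<Rightarrow>\<^sub>0 'a) \<Rightarrow> 'a poly \<Rightarrow> 'a poly" where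
  "mpoly_action fs p v = (\<Sum>e \<in> Poly_Mapping.keys p.
    Polynomial.smult (Poly_Mapping.lookup p e) (monomial_action fs (length fs) e v))"

text \<open>Cancellation can make the support of a sum smaller than the union of the supports;
  summing over a common superset avoids comparing them.\<close>

lemma mpoly_action_superset:
  assumes "finite S" "Poly_Mapping.keys p \<subseteq> S"
  shows "mpoly_action fs p v = (\<Sum>e \<in> S.
    Polynomial.smult (Poly_Mapping.lookup p e) (monomial_action fs (length fs) e v))"
  unfolding mpoly_action_def using assms
  by (intro sum.mono_neutral_left) (auto simp: in_keys_iff)

lemma mpoly_action_add_left: "mpoly_action fs (p + q) v = mpoly_action fs p v + mpoly_action fs q v"
  using Poly_Mapping.keys_add[of p q]
  by (simp add: mpoly_action_superset[of "Poly_Mapping.keys p \<union> Poly_Mapping.keys q"]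
        lookup_add smult_add_left sum.distrib)

lemma mpoly_action_single:
  "mpoly_action fs (Poly_Mapping.single e c) v =
    Polynomial.smult c (monomial_action fs (length fs) e v)"
  by (subst mpoly_action_superset[of "{e}"]) (auto simp: split: if_splits)

text \<open>Reduces identities that are additive in the polynomial to single terms.\<close>

lemma poly_mapping_add_induct [case_names single add]:
  fixes p :: "'k \<Rightarrow>\<^sub>0 'b::monoid_add"
  assumes "\<And>a b. P (Poly_Mapping.single a b)" "\<And>p q. P p \<Longrightarrow> P q \<Longrightarrow> P (p + q)"
  shows "P p"
proof (induction p rule: update_induct)
  case const
  show ?case using assms(1)[of _ 0] by simp
qed (simp add: assms update_eq_add)

locale commuting_endos =
  fixes m :: nat and fs :: "('a::comm_ring_1 poly \<Rightarrow> 'a poly) list"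
  assumes endo: "f \<in> set fs \<Longrightarrow> f \<in> poly_endos m"
    and comm: "f \<in> set fs \<Longrightarrow> g \<in> set fs \<Longrightarrow> f \<circ> g = g \<circ> f"
begin

lemma nth_endo: "i < length fs \<Longrightarrow> fs ! i \<in> poly_endos m"
  by (simp add: endo)

lemma mpoly_action_closed: "v \<in> small_polys m \<Longrightarrow> mpoly_action fs p v \<in> small_polys m"
proof (induction p rule: poly_mapping_add_induct)
  case (single e c)
  have "monomial_action fs (length fs) e v \<in> small_polys m"
    using single poly_endosD(3)[OF nth_endo] by (intro monomial_action_invariant)
  thus ?case by (simp add: mpoly_action_single)
qed (simp add: mpoly_action_add_left)

lemma mpoly_action_smult_right:
  "mpoly_action fs p (Polynomial.smult c v) = Polynomial.smult c (mpoly_action fs p v)"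
proof -
  have "monomial_action fs (length fs) e (Polynomial.smult c v) =
      Polynomial.smult c (monomial_action fs (length fs) e v)" for e
    by (rule monomial_action_hom) (simp add: fun_eq_iff poly_endosD[OF nth_endo])
  thus ?thesis
    by (induction p rule: poly_mapping_add_induct)
       (simp_all add: mpoly_action_single mpoly_action_add_left mult.commute smult_add_right)
qed

lemma mpoly_action_add_right:
  "mpoly_action fs p (v + w) = mpoly_action fs p v + mpoly_action fs p w"
proof -
  have "monomial_action fs (length fs) e (v + w) =
      monomial_action fs (length fs) e v + monomial_action fs (length fs) e w" for e
    by (rule monomial_action_additive) (simp add: poly_endosD[OF nth_endo])
  thus ?thesis
    by (induction p rule: poly_mapping_add_induct)
       (simp_all add: mpoly_action_single mpoly_action_add_left smult_add_right)
qed

text \<open>Both sides are additive in \<open>p\<close> and in \<open>q\<close>, which leaves single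
  terms; there the exponents add by \<open>monomial_action_add\<close>.\<close>

lemma mpoly_action_mult: "mpoly_action fs (p * q) v = mpoly_action fs p (mpoly_action fs q v)"
proof (induction p rule: poly_mapping_add_induct)
  case (single a b)
  show ?case
  proof (induction q rule: poly_mapping_add_induct)
    case (single c d)
    have "monomial_action fs (length fs) (a + c) v =
        monomial_action fs (length fs) a (monomial_action fs (length fs) c v)"
      using comm by (subst monomial_action_add) auto
    thus ?case
      \<comment> \<open>The inner coefficient \<open>d\<close> is pulled out through the outer
        action.\<close>
      using mpoly_action_smult_right[of "Poly_Mapping.single a b" d]
      by (simp add: mult_single mpoly_action_single mult.commute)
  qed (simp add: distrib_left mpoly_action_add_left mpoly_action_add_right)
qed (simp add: distrib_right mpoly_action_add_left)

lemma mpoly_action_var: "i < length fs \<Longrightarrow> mpoly_action fs (mpoly_var i) v = (fs ! i) v"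
  using monomial_action_single[of i "length fs" fs] by (simp add: mpoly_var_def mpoly_action_single)

text \<open>Holds for every \<open>v\<close>, also beyond degree \<open>m\<close>, because
  \<open>monomial_action\<close> starts from \<open>id\<close> and not from
  \<open>poly_cutoff m\<close>.\<close>

lemma mpoly_action_const: "mpoly_action fs (mpoly_const c) v = Polynomial.smult c v"
  by (simp add: mpoly_const_def mpoly_action_single monomial_action_id)

end

text \<open>The fields \<open>mult\<close> and \<open>one\<close> have the same values as in
  \<open>endo_module\<close>, which makes \<open>underlying_endo_module\<close> an equality of
  records.\<close>

definition poly_space :: "nat \<Rightarrow> ('a::comm_ring_1, 'a poly) module" where
  "poly_space m = \<lparr> carrier = small_polys m, mult = (\<lambda>_ _. 0), one = 0, zero = 0, add = (+),
    smult = Polynomial.smult \<rparr>"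

definition endo_module ::
    "nat \<Rightarrow> ('a::comm_ring_1 poly \<Rightarrow> 'a poly) list \<Rightarrow> ((nat \<Rightarrow>\<^sub>0 nat) \<Rightarrow>\<^sub>0 'a, 'a poly) module" where
  "endo_module m fs = \<lparr> carrier = small_polys m, mult = (\<lambda>_ _. 0), one = 0, zero = 0, add = (+),
    smult = mpoly_action fs \<rparr>"

lemma endo_module_simps [simp]:
  "carrier (endo_module m fs) = small_polys m" "add (endo_module m fs) = (+)"
  "zero (endo_module m fs) = 0" "module.smult (endo_module m fs) = mpoly_action fs"
  by (simp_all add: endo_module_def)

lemma poly_space_simps [simp]:
  "carrier (poly_space m) = small_polys m" "add (poly_space m) = (+)"
  "zero (poly_space m) = 0" "module.smult (poly_space m) = Polynomial.smult"
  by (simp_all add: poly_space_def)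

text \<open>Here \<open>n\<close> is independent of \<open>length fs\<close>: a variable of index at
  least \<open>length fs\<close> acts as the identity.\<close>

lemma (in commuting_endos) module_endo_module:
  "Module.module (mpoly_ring n) (endo_module m fs)"
proof (intro moduleI mpoly_ring_cring abelian_groupI)
  fix v assume "v \<in> carrier (endo_module m fs)"
  thus "\<exists>w\<in>carrier (endo_module m fs). w \<oplus>\<^bsub>endo_module m fs\<^esub> v = \<zero>\<^bsub>endo_module m fs\<^esub>"
    by (intro bexI[of _ "- v"]) auto
next
  fix v
  show "\<one>\<^bsub>mpoly_ring n\<^esub> \<odot>\<^bsub>endo_module m fs\<^esub> v = v"
    using mpoly_action_const[of 1] by (simp add: mpoly_const_hom)
qed (auto simp: mpoly_action_closed mpoly_action_add_left mpoly_action_add_right mpoly_action_mult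
       add_ac)

lemma (in commuting_endos) underlying_endo_module: "underlying_vs (endo_module m fs) = poly_space m"
  by (simp add: underlying_vs_def poly_space_def endo_module_def mpoly_action_const fun_eq_iff)

section \<open>Classification of modules\<close>

text \<open>The empty list of endomorphisms gives a module over the polynomial ring in no variables,
  and its underlying vector space is \<open>poly_space m\<close>.\<close>

lemma vectorspace_poly_space: "vectorspace class_ring (poly_space m :: ('a::field, 'a poly) module)"
proof -
  interpret commuting_endos m "[] :: ('a poly \<Rightarrow> 'a poly) list"
    by unfold_locales auto
  show ?thesis
    using underlying_vectorspace[OF module_endo_module[of 0]] by (simp add: underlying_endo_module)
qed

text \<open>A basis of \<open>V\<close>, numbered by a bijection \<open>h\<close>, turns the
  coefficients of a polynomial into coordinates of a vector.\<close>

lemma poly_space_isomorphic: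
  fixes V :: "('a::field, 'v) module"
  assumes V: "vectorspace class_ring V" and fd: "vectorspace.fin_dim class_ring V"
    and dim: "vectorspace.dim class_ring V = m"
  shows "module_isomorphic class_ring (poly_space m) V"
proof -
  interpret V: vectorspace class_ring V by fact
  obtain A where A: "finite A" "V.basis A" using V.finite_basis_exists[OF fd] by blast
  have AV: "A \<subseteq> carrier V" using A by (simp add: V.basis_def)
  have "card A = m" using V.dim_basis[OF A] dim by simp
  then obtain h where h: "bij_betw h A {..<m}"
    using A(1) by (metis bij_betw_iff_card card_lessThan finite_lessThan)
  \<comment> \<open>Restricting to \<open>A\<close> makes \<open>c p\<close> extensional, so that a
    vector determines its coordinate function uniquely.\<close>
  define c where "c p = restrict (\<lambda>b. poly.coeff p (h b)) A" for p :: "'a poly"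
  interpret L: linear_map class_ring "class_ring.func_space A" V "\<lambda>a. V.lincomb a A"
    by (rule V.lincomb_is_linear[OF A(1) AV])
  have c: "c p \<in> carrier (class_ring.func_space A)" for p
    by (simp add: c_def class_ring.func_space_def)
  have c_add: "c (p + q) = c p \<oplus>\<^bsub>class_ring.func_space A\<^esub> c q" for p q
    by (auto simp: c_def class_ring.func_space_def fun_eq_iff)
  have c_smult: "c (Polynomial.smult k p) = k \<odot>\<^bsub>class_ring.func_space A\<^esub> c p" for k p
    by (auto simp: c_def class_ring.func_space_def fun_eq_iff)
  have "(\<lambda>p. V.lincomb (c p) A) \<in> module_hom class_ring (poly_space m) V"
    using L.T_add[OF c c] L.T_smult[OF _ c] funcset_mem[OF module_hom_closed[OF L.T_hom] c]
    by (auto simp: LinearCombinations.module_hom_def c_add c_smult)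
  moreover have "bij_betw c (small_polys m) (A \<rightarrow>\<^sub>E UNIV)"
  proof (rule bij_betw_imageI)
    show "inj_on c (small_polys m)"
    proof (rule inj_onI, rule poly_eqI)
      fix p q i assume pq: "p \<in> small_polys m" "q \<in> small_polys m" "c p = c q"
      show "poly.coeff p i = poly.coeff q i"
      proof (cases "i < m")
        case True
        then obtain b where "b \<in> A" "h b = i"
          using bij_betw_imp_surj_on[OF h] by (metis imageE lessThan_iff)
        with fun_cong[OF pq(3), of b] show ?thesis by (simp add: c_def)
      qed (use pq in \<open>simp add: small_polys_iff\<close>)
    qed
    show "c ` small_polys m = A \<rightarrow>\<^sub>E UNIV"
    proof (intro equalityI subsetI)
      fix a :: "'v \<Rightarrow> 'a" assume a: "a \<in> A \<rightarrow>\<^sub>E UNIV"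
      \<comment> \<open>This is the polynomial whose coefficient at \<open>h b\<close> is
        \<open>a b\<close>.\<close>
      define p where "p = (\<Sum>i<m. monom (a (inv_into A h i)) i)"
      have p: "poly.coeff p i = (if i < m then a (inv_into A h i) else 0)" for i
        by (simp add: p_def coeff_sum)
      have "c p b = a b" for b
      proof (cases "b \<in> A")
        case True
        hence "h b < m" "inv_into A h (h b) = b"
          using bij_betwE[OF h] bij_betw_imp_inj_on[OF h] by auto
        thus ?thesis using True by (simp add: c_def p)
      next
        case False
        thus ?thesis using PiE_arb[OF a False] by (simp add: c_def)
      qed
      hence "a = c p" by auto
      thus "a \<in> c ` small_polys m"
        by (rule image_eqI) (simp add: small_polys_iff p)
    qed (auto simp: c_def)
  qed
  moreover have "bij_betw (\<lambda>a. V.lincomb a A) (A \<rightarrow>\<^sub>E UNIV) (carrier V)"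
  proof -
    have ex1: "\<exists>!a. a \<in> A \<rightarrow>\<^sub>E UNIV \<and> V.lincomb a A = v" if "v \<in> carrier V" for v
      using V.basis_criterion[OF A(1) AV] A(2) that by simp
    have closed: "V.lincomb a A \<in> carrier V" for a
      using AV by simp
    show ?thesis
      unfolding bij_betw_def inj_on_def using ex1 closed
      by (metis (no_types, lifting) image_iff subsetI subset_antisym)
  qed
  ultimately have "bij_betw (\<lambda>p. V.lincomb (c p) A) (carrier (poly_space m)) (carrier V)"
    using bij_betw_trans by (fastforce simp: comp_def)
  thus ?thesis
    using \<open>(\<lambda>p. V.lincomb (c p) A) \<in> _\<close> by (auto simp: module_isomorphic_def)
qed

text \<open>The isomorphism just constructed assumes only the dimension of its target. Taking
  coordinate vectors of length \<open>m\<close> as target and inverting it transports their known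
  dimension to \<open>poly_space m\<close>.\<close>

lemma
  shows fin_dim_poly_space:
    "vectorspace.fin_dim class_ring (poly_space m :: ('a::field, 'a poly) module)"
    and dim_poly_space:
    "vectorspace.dim class_ring (poly_space m :: ('a::field, 'a poly) module) = m"
proof -
  let ?V = "module_vec TYPE('a) m"
  interpret V: vec_space "TYPE('a)" m .
  interpret P: vectorspace class_ring "poly_space m :: ('a, 'a poly) module"
    by (rule vectorspace_poly_space)
  have V: "vectorspace class_ring ?V" by unfold_locales
  have "module_isomorphic class_ring (poly_space m) ?V"
    by (rule poly_space_isomorphic[OF V]) (simp_all add: V.dim_is_n)
  hence "module_isomorphic class_ring ?V (poly_space m)"
    by (rule module_isomorphic_sym[OF P.module.module_axioms])
  then obtain f where f: "f \<in> module_hom class_ring ?V (poly_space m)"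
    "bij_betw f (carrier ?V) (carrier (poly_space m))"
    by (auto simp: module_isomorphic_def)
  interpret W: vectorspace class_ring ?V by (rule V)
  interpret T: linear_map class_ring ?V "poly_space m" f
    using f by unfold_locales
  show "P.fin_dim" "P.dim = m"
    using T.surj_fin_dim T.dim_eq f V.fin_dim V.dim_is_n by (auto simp: bij_betw_def)
qed

section \<open>Modules as commuting tuples, isomorphism as conjugation\<close>

lemma is_mpoly_module_endo_module:
  fixes fs :: "('a::field poly \<Rightarrow> 'a poly) list"
  assumes "commuting_endos m fs"
  shows "is_mpoly_module n m (endo_module m fs)"
proof -
  interpret commuting_endos m fs by fact
  show ?thesis
    unfolding is_mpoly_module_def underlying_endo_module
    using module_endo_module fin_dim_poly_space dim_poly_space by blast
qed

text \<open>A homomorphism is controlled only on \<open>small_polys m\<close>; truncating first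
  yields the extension that \<open>poly_endos m\<close> asks for.\<close>

lemma module_hom_endo_module:
  fixes fs gs :: "('a::field poly \<Rightarrow> 'a poly) list"
  assumes "commuting_endos m fs" "commuting_endos m gs"
    and f: "f \<in> module_hom (mpoly_ring n) (endo_module m fs) (endo_module m gs)"
  shows "f \<circ> poly_cutoff m \<in> poly_endos m"
proof -
  have "f (Polynomial.smult c v) = Polynomial.smult c (f v)" if "v \<in> small_polys m" for c v
    using LinearCombinations.module_hom_smult[OF f mpoly_const_carrier[of c], of v] that
    by (simp add: commuting_endos.mpoly_action_const[OF assms(1)]
          commuting_endos.mpoly_action_const[OF assms(2)])
  moreover have "f (v + w) = f v + f w" if "v \<in> small_polys m" "w \<in> small_polys m" for v w
    using LinearCombinations.module_hom_add[OF f, of v w] that by simp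
  moreover have "f v \<in> small_polys m" if "v \<in> small_polys m" for v
    using funcset_mem[OF LinearCombinations.module_hom_closed[OF f], of v] that by simp
  ultimately show ?thesis
    by (simp add: poly_endos_def poly_cutoff_add poly_cutoff_smult)
qed

text \<open>A module isomorphism is a linear bijection that intertwines the variables, and linear
  bijections of the model space correspond to units of \<open>endo_monoid m\<close>.\<close>

lemma endo_module_isomorphic_iff:
  fixes fs gs :: "('a::field poly \<Rightarrow> 'a poly) list"
  assumes fs: "commuting_endos m fs" "length fs = n"
    and gs: "commuting_endos m gs" "length gs = n"
  shows "module_isomorphic (mpoly_ring n) (endo_module m fs) (endo_module m gs) \<longleftrightarrow>
    (\<exists>u \<in> Units (endo_monoid m). \<forall>i<n. u \<circ> fs ! i = gs ! i \<circ> u)" (is "?iso \<longleftrightarrow> ?conj")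
proof
  assume ?iso
  then obtain f where f: "f \<in> module_hom (mpoly_ring n) (endo_module m fs) (endo_module m gs)"
    and b: "bij_betw f (small_polys m) (small_polys m)"
    by (auto simp: module_isomorphic_def)
  let ?g = "inv_into (small_polys m) f"
  have g: "?g v \<in> small_polys m" "f (?g v) = v" "?g (f v) = v" if "v \<in> small_polys m" for v
    using b that by (auto simp: bij_betw_def inv_into_into f_inv_into_f)
  have fv: "f v \<in> small_polys m" if "v \<in> small_polys m" for v
    using b that by (auto simp: bij_betw_def)
  \<comment> \<open>With truncation in front, the two maps become mutually inverse in
    \<open>endo_monoid m\<close>, whose unit is truncation.\<close>
  let ?u = "f \<circ> poly_cutoff m" and ?w = "?g \<circ> poly_cutoff m"
  have u: "?u \<in> poly_endos m"
    by (rule module_hom_endo_module[OF fs(1) gs(1) f])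
  have "?w \<in> poly_endos m"
  proof -
    \<comment> \<open>Linearity passes to the inverse: both sides of each identity have the same
      image under the injective \<open>f\<close>.\<close>
    have inj: "v = w" if "f v = f w" "v \<in> small_polys m" "w \<in> small_polys m" for v w
      using that g(3) by metis
    have fadd: "f (v + w) = f v + f w" if "v \<in> small_polys m" "w \<in> small_polys m" for v w
      using poly_endosD(1)[OF u, of v w] that by simp
    have fsmult: "f (Polynomial.smult c v) = Polynomial.smult c (f v)" if "v \<in> small_polys m" for c v
      using poly_endosD(2)[OF u, of c v] that by simp
    have "?g (v + w) = ?g v + ?g w" if "v \<in> small_polys m" "w \<in> small_polys m" for v w
      by (rule inj) (use that in \<open>simp_all add: g fadd\<close>)
    moreover have "?g (Polynomial.smult c v) = Polynomial.smult c (?g v)"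
      if "v \<in> small_polys m" for c v
      by (rule inj) (use that in \<open>simp_all add: g fsmult\<close>)
    ultimately show ?thesis
      by (simp add: poly_endos_def poly_cutoff_add poly_cutoff_smult g)
  qed
  moreover have "?u \<circ> ?w = poly_cutoff m" "?w \<circ> ?u = poly_cutoff m"
    by (simp_all add: fun_eq_iff g fv)
  ultimately have "?u \<in> Units (endo_monoid m)"
    using u unfolding Units_def endo_monoid_simps by blast
  moreover have "?u \<circ> fs ! i = gs ! i \<circ> ?u" if i: "i < n" for i
  proof
    fix p
    have "f ((fs ! i) (poly_cutoff m p)) = (gs ! i) (f (poly_cutoff m p))"
      using LinearCombinations.module_hom_smult[OF f mpoly_var_carrier[OF i], of "poly_cutoff m p"]
        i fs(2) gs(2)
      by (simp add: commuting_endos.mpoly_action_var[OF fs(1)]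
            commuting_endos.mpoly_action_var[OF gs(1)])
    \<comment> \<open>Truncation on either side of \<open>fs ! i\<close> can therefore be
      dropped.\<close>
    moreover have "(fs ! i) (poly_cutoff m p) = (fs ! i) p" "(fs ! i) p \<in> small_polys m"
      using commuting_endos.nth_endo[OF fs(1), of i] i fs(2) by (auto simp: poly_endosD)
    ultimately show "(?u \<circ> fs ! i) p = (gs ! i \<circ> ?u) p"
      by simp
  qed
  ultimately show ?conj by blast
next
  assume ?conj
  then obtain u where u: "u \<in> Units (endo_monoid m)" "\<And>i. i < n \<Longrightarrow> u \<circ> fs ! i = gs ! i \<circ> u"
    by blast
  then obtain w where uw: "u \<in> poly_endos m" "w \<in> poly_endos m"
    "u \<circ> w = poly_cutoff m" "w \<circ> u = poly_cutoff m"
    by (auto simp: Units_def)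
  have "u ((fs ! i) v) = (gs ! i) (u v)" if "i < n" for i v
    using fun_cong[OF u(2)[OF that]] by simp
  hence "u \<in> module_hom (mpoly_ring n) (endo_module m fs) (endo_module m gs)"
    using fs gs poly_endosD[OF uw(1)]
    by (intro module_hom_mpoly_ringI commuting_endos.module_endo_module)
       (simp_all add: commuting_endos.mpoly_action_const[OF fs(1)]
          commuting_endos.mpoly_action_const[OF gs(1)] commuting_endos.mpoly_action_var[OF fs(1)]
          commuting_endos.mpoly_action_var[OF gs(1)])
  moreover have "bij_betw u (small_polys m) (small_polys m)"
    using fun_cong[OF uw(3)] fun_cong[OF uw(4)] poly_endosD(3)[OF uw(1)] poly_endosD(3)[OF uw(2)]
    by (intro bij_betwI[of _ _ _ w]) auto
  ultimately show ?iso
    by (auto simp: module_isomorphic_def)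
qed

text \<open>Transport of structure along a linear bijection from the model space; by
  \<open>module_hom_mpoly_ringI\<close> it suffices to match scalars and variables.\<close>

lemma mpoly_module_isomorphic_endo_module:
  fixes M :: "((nat \<Rightarrow>\<^sub>0 nat) \<Rightarrow>\<^sub>0 'a::field, 'v) module"
  assumes M: "is_mpoly_module n m M"
  obtains fs where "commuting_endos m fs" "length fs = n"
    "module_isomorphic (mpoly_ring n) (endo_module m fs) M"
proof -
  interpret M: Module.module "mpoly_ring n" M using M by (simp add: is_mpoly_module_def)
  interpret V: vectorspace class_ring "underlying_vs M"
    by (rule underlying_vectorspace[OF M.module_axioms])
  interpret P: vectorspace class_ring "poly_space m :: ('a, 'a poly) module"
    by (rule vectorspace_poly_space)
  let ?P = "small_polys m :: 'a poly set"
  have "module_isomorphic class_ring (poly_space m) (underlying_vs M)"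
    using M by (intro poly_space_isomorphic V.vectorspace_axioms) (auto simp: is_mpoly_module_def)
  then obtain f where hom: "f \<in> module_hom class_ring (poly_space m) (underlying_vs M)"
    and b: "bij_betw f ?P (carrier M)"
    by (auto simp: module_isomorphic_def)
  define g where "g = inv_into ?P f"
  have g [simp]: "g x \<in> ?P" "f (g x) = x" if "x \<in> carrier M" for x
    using b that by (auto simp: bij_betw_def inv_into_into f_inv_into_f g_def)
  have gf [simp]: "g (f v) = v" and f [simp]: "f v \<in> carrier M" if "v \<in> ?P" for v
    using b that by (auto simp: bij_betw_def g_def)
  have f_add: "f (v + w) = f v \<oplus>\<^bsub>M\<^esub> f w" if "v \<in> ?P" "w \<in> ?P" for v w
    using LinearCombinations.module_hom_add[OF hom, of v w] that by simp
  have f_smult: "f (Polynomial.smult c v) = mpoly_const c \<odot>\<^bsub>M\<^esub> f v" if "v \<in> ?P" for c v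
    using LinearCombinations.module_hom_smult[OF hom, of c v] that by simp
  have g_add: "g (x \<oplus>\<^bsub>M\<^esub> y) = g x + g y" if "x \<in> carrier M" "y \<in> carrier M" for x y
    using that gf[of "g x + g y"] by (simp add: f_add)
  have g_smult: "g (mpoly_const c \<odot>\<^bsub>M\<^esub> x) = Polynomial.smult c (g x)" if "x \<in> carrier M" for c x
    using that gf[of "Polynomial.smult c (g x)"] by (simp add: f_smult)
  \<comment> \<open>\<open>F i\<close> is multiplication by the variable of index \<open>i\<close>,
    carried over to polynomials along \<open>f\<close>.\<close>
  define F where "F i p = g (mpoly_var i \<odot>\<^bsub>M\<^esub> f (poly_cutoff m p))" for i p
  have x_closed [simp]: "mpoly_var i \<odot>\<^bsub>M\<^esub> x \<in> carrier M" if "i < n" "x \<in> carrier M" for i x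
    using that by simp
  \<comment> \<open>Used twice: a variable and a constant give that \<open>F i\<close> respects
    scalars, two variables give that \<open>F i\<close> and \<open>F j\<close> commute.\<close>
  have swap: "r \<odot>\<^bsub>M\<^esub> (s \<odot>\<^bsub>M\<^esub> x) = s \<odot>\<^bsub>M\<^esub> (r \<odot>\<^bsub>M\<^esub> x)"
    if "r \<in> carrier (mpoly_ring n)" "s \<in> carrier (mpoly_ring n)" "x \<in> carrier M" for r s x
    using that M.smult_assoc1[of r s x] M.smult_assoc1[of s r x] by (simp add: mult.commute)
  have endo: "F i \<in> poly_endos m" if "i < n" for i
    using that swap[of "mpoly_var i" "mpoly_const _"]
    by (simp add: poly_endos_def F_def poly_cutoff_add poly_cutoff_smult f_add f_smult
          M.smult_r_distr g_add g_smult)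
  have comm: "F i \<circ> F j = F j \<circ> F i" if "i < n" "j < n" for i j
    using that swap[of "mpoly_var i" "mpoly_var j"] by (simp add: F_def fun_eq_iff)
  let ?fs = "map F [0..<n]"
  have fs: "commuting_endos m ?fs"
    using endo comm by unfold_locales auto
  have "f \<in> module_hom (mpoly_ring n) (endo_module m ?fs) M"
    using fs
    by (intro module_hom_mpoly_ringI commuting_endos.module_endo_module M.module_axioms)
       (simp_all add: commuting_endos.mpoly_action_const[OF fs]
          commuting_endos.mpoly_action_var[OF fs] f_add f_smult F_def)
  hence "module_isomorphic (mpoly_ring n) (endo_module m ?fs) M"
    using b by (auto simp: module_isomorphic_def)
  with fs show thesis by (intro that[of ?fs]) auto
qed

section \<open>Isomorphism classes and conjugation orbits\<close>

lemma endo_monoid_commuting_lists: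
  "fs \<in> monoid.commuting_lists (endo_monoid m) (poly_endos m) n \<longleftrightarrow>
    commuting_endos m fs \<and> length fs = n"
  by (auto simp: monoid.commuting_lists_def[OF monoid_endo_monoid] related_lists_def
        commuting_endos_def)

text \<open>The two maps have the same fibres on \<open>A\<close>, so sending \<open>f x\<close> to
  \<open>g x\<close> is well defined and bijective.\<close>

lemma card_image_cong:
  assumes "\<And>x y. x \<in> A \<Longrightarrow> y \<in> A \<Longrightarrow> f x = f y \<longleftrightarrow> g x = g y"
  shows "card (f ` A) = card (g ` A)"
proof (rule bij_betw_same_card)
  let ?h = "g \<circ> inv_into A f"
  have h: "?h (f x) = g x" if "x \<in> A" for x
    using assms[of "inv_into A f (f x)" x] that by (auto simp: inv_into_into f_inv_into_f)
  show "bij_betw ?h (f ` A) (g ` A)"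
  proof (rule bij_betw_imageI)
    show "inj_on ?h (f ` A)" using h assms by (auto simp: inj_on_def simp del: o_apply)
    show "?h ` f ` A = g ` A" using h by (force simp: image_iff simp del: o_apply)
  qed
qed

text \<open>Orbits that meet coincide, so equality says that \<open>ys\<close> is a conjugate of
  \<open>xs\<close>; the inverse-free form matches
  \<open>endo_module_isomorphic_iff\<close>.\<close>

lemma (in monoid) orbit_conj_action_eq_iff:
  assumes xs: "xs \<in> commuting_lists (carrier G) n" and ys: "ys \<in> commuting_lists (carrier G) n"
  shows "orbit (units_of G) (conj_action n) xs = orbit (units_of G) (conj_action n) ys \<longleftrightarrow>
    (\<exists>g \<in> Units G. \<forall>i<n. g \<otimes> xs ! i = ys ! i \<otimes> g)"
proof -
  interpret A: group_action "units_of G" "commuting_lists (carrier G) n" "conj_action n"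
    by (rule group_action_conj_action)
  let ?orb = "orbit (units_of G) (conj_action n)"
  have "?orb xs = ?orb ys \<longleftrightarrow> ys \<in> ?orb xs"
  proof
    assume ys': "ys \<in> ?orb xs"
    hence "xs \<in> ?orb ys"
      using A.orbit_sym xs ys by blast
    moreover have "?orb zs \<subseteq> commuting_lists (carrier G) n"
      if "zs \<in> commuting_lists (carrier G) n" for zs
      using that A.element_image by (auto simp: orbit_def)
    ultimately show "?orb xs = ?orb ys"
      using A.orbit_trans ys' xs ys by blast
  qed (use A.orbit_refl[OF ys] in simp)
  also have "\<dots> \<longleftrightarrow> (\<exists>g \<in> Units G. map (conjugate g) xs = ys)"
    using xs by (auto simp: orbit_def conj_action_def units_of_carrier)
  also have "\<dots> \<longleftrightarrow> (\<exists>g \<in> Units G. \<forall>i<n. g \<otimes> xs ! i = ys ! i \<otimes> g)"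
  proof (rule bex_cong[OF refl])
    fix g assume g: "g \<in> Units G"
    have "xs ! i \<in> carrier G" "ys ! i \<in> carrier G" if "i < n" for i
      using that xs ys commuting_listsD by (metis nth_mem)+
    thus "map (conjugate g) xs = ys \<longleftrightarrow> (\<forall>i<n. g \<otimes> xs ! i = ys ! i \<otimes> g)"
      using g commuting_listsD(1)[OF xs] commuting_listsD(1)[OF ys]
      by (simp add: list_eq_iff_nth_eq conjugate_eq_iff)
  qed
  finally show ?thesis .
qed

text \<open>Classes and orbits are both images of the set of commuting lists, under maps with the
  same fibres, so \<open>card_image_cong\<close> applies.\<close>

lemma num_iso_classes_eq_card_orbits:
  "num_iso_classes TYPE('a::{field, finite}) m n =
    card (orbits (units_of (endo_monoid m))
      (monoid.commuting_lists (endo_monoid m) (poly_endos m :: ('a poly \<Rightarrow> 'a poly) set) n)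
      (monoid.conj_action (endo_monoid m) n))"
proof -
  interpret E: monoid "endo_monoid m :: ('a poly \<Rightarrow> 'a poly) monoid"
    by (rule monoid_endo_monoid)
  let ?T = "E.commuting_lists (poly_endos m) n"
  let ?iso = "mpoly_module_iso n m :: ((nat \<Rightarrow>\<^sub>0 nat) \<Rightarrow>\<^sub>0 'a, nat) module rel"
  let ?orb = "orbit (units_of (endo_monoid m)) (E.conj_action n)"
  note equiv = equiv_mpoly_module_iso[of n m, where 'a = 'a]
  have T: "commuting_endos m fs" "length fs = n" "is_mpoly_module n m (endo_module m fs)"
    if "fs \<in> ?T" for fs
    using that is_mpoly_module_endo_module by (auto simp: endo_monoid_commuting_lists)
  hence "\<exists>N \<in> mpoly_modules n m. module_isomorphic (mpoly_ring n) (endo_module m fs) N"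
    if "fs \<in> ?T" for fs
    using that by (intro mpoly_module_nat_representative)
  \<comment> \<open>The classes counted consist of modules with carrier in \<open>nat\<close>, so
    each \<open>endo_module m fs\<close> is replaced by an isomorphic copy
    \<open>rep fs\<close>.\<close>
  then obtain rep :: "_ \<Rightarrow> ((nat \<Rightarrow>\<^sub>0 nat) \<Rightarrow>\<^sub>0 'a, nat) module"
    where rep: "\<And>fs. fs \<in> ?T \<Longrightarrow> rep fs \<in> mpoly_modules n m"
      "\<And>fs. fs \<in> ?T \<Longrightarrow> module_isomorphic (mpoly_ring n) (endo_module m fs) (rep fs)"
    by metis
  have module: "Module.module (mpoly_ring n) N" if "is_mpoly_module n m N"
    for N :: "((nat \<Rightarrow>\<^sub>0 nat) \<Rightarrow>\<^sub>0 'a, 'a poly) module"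
    using that by (simp add: is_mpoly_module_def)
  have rep': "module_isomorphic (mpoly_ring n) (rep fs) (endo_module m fs)" if "fs \<in> ?T" for fs
    by (rule module_isomorphic_sym[OF module[OF T(3)[OF that]] rep(2)[OF that]])
  have "?iso `` {rep fs} = ?iso `` {rep gs} \<longleftrightarrow> ?orb fs = ?orb gs"
    if "fs \<in> ?T" "gs \<in> ?T" for fs gs
  proof -
    have "?iso `` {rep fs} = ?iso `` {rep gs} \<longleftrightarrow> module_isomorphic (mpoly_ring n) (rep fs) (rep gs)"
      using eq_equiv_class_iff[OF equiv rep(1)[OF that(1)] rep(1)[OF that(2)]] rep(1) that
      by (simp add: mpoly_module_iso_def)
    also have "\<dots> \<longleftrightarrow> module_isomorphic (mpoly_ring n) (endo_module m fs) (endo_module m gs)"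
      using that rep(2) rep' module_isomorphic_trans by meson
    also have "\<dots> \<longleftrightarrow> ?orb fs = ?orb gs"
      using that T E.orbit_conj_action_eq_iff[of fs n gs] by (simp add: endo_module_isomorphic_iff)
    finally show ?thesis .
  qed
  hence "card ((\<lambda>fs. ?iso `` {rep fs}) ` ?T) = card (?orb ` ?T)"
    by (rule card_image_cong)
  \<comment> \<open>No class is missed, since every module comes from a commuting list by
    \<open>mpoly_module_isomorphic_endo_module\<close>.\<close>
  moreover have "(\<lambda>fs. ?iso `` {rep fs}) ` ?T = mpoly_modules n m // ?iso"
  proof (intro equalityI subsetI)
    fix X assume "X \<in> mpoly_modules n m // ?iso"
    then obtain M where M: "M \<in> mpoly_modules n m" "X = ?iso `` {M}"
      by (auto simp: quotient_def)
    then obtain fs where fs: "commuting_endos m fs" "length fs = n"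
      "module_isomorphic (mpoly_ring n) (endo_module m fs) M"
      using mpoly_module_isomorphic_endo_module[of n m M] by (auto simp: mpoly_modules_def)
    hence fsT: "fs \<in> ?T" by (simp add: endo_monoid_commuting_lists)
    have "module_isomorphic (mpoly_ring n) (rep fs) M"
      using module_isomorphic_trans[OF rep'[OF fsT] fs(3)] .
    hence "X = ?iso `` {rep fs}"
      using M rep(1)[OF fsT] equiv_class_eq[OF equiv, of "rep fs" M]
      by (simp add: mpoly_module_iso_def)
    thus "X \<in> (\<lambda>fs. ?iso `` {rep fs}) ` ?T" using fsT by blast
  qed (auto intro: quotientI rep)
  moreover have "?orb ` ?T = orbits (units_of (endo_monoid m)) ?T (E.conj_action n)"
    by (auto simp: orbits_def)
  ultimately show ?thesis by (simp add: num_iso_classes_def)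
qed

theorem theorem6:
  fixes m :: nat
  assumes "m > 0"
  shows "is_rational_fps (iso_class_series TYPE('a::{field, finite}) m)"
  using monoid.rational_orbits_commuting_lists[OF monoid_endo_monoid, of m, where 'a1 = 'a]
  by (simp add: iso_class_series_def num_iso_classes_eq_card_orbits finite_poly_endos)

end
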